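(* Let $A\in\mathbb R^{m\times n}$ have full row rank, $b\in\mathbb R^m$, and let $f\in C^{1,1}_{loc}(\mathbb R^n,\mathbb R)$ be coercive, $\beta_1$-strongly convex and $\beta_2$-strongly smooth for some $\beta_1,\beta_2>0$, with conjugate $f^*\in C^{1,1}_{loc}(\mathbb R^n,\mathbb R)$. Let $x^\star$ be the optimal point of $\min_{x\in\mathbb R^n} f(x)$ subject to $Ax=b$. Let $L(x,\nu)=f(x)+\nu^T(Ax-b)$, let $g(\nu)=\inf_{x\in\mathbb R^n}L(x,\nu)$, and let $\nu^\star$ be the maximizer of $g$ over $\mathbb R^m$. Let $c_1,c_2,d_1,d_2>0$, $p_1,q_1>2$, $1<p_2,q_2<2$, and consider $$\dot\nu=c_1\frac{\nabla g(\nu)}{\|\nabla g(\nu)\|^{\frac{p_1-2}{p_1-1}}}+c_2\frac{\nabla g(\nu)}{\|\nabla g(\nu)\|^{\frac{p_2-2}{p_2-1}}},\qquad (\mathrm{I})$$ $$\dot x=-d_1\frac{\nabla_xL(x,\nu^\star)}{\|\nabla_xL(x,\nu^\star)\|^{\frac{q_1-2}{q_1-1}}}-d_2\frac{\nabla_xL(x,\nu^\star)}{\|\nabla_xL(x,\nu^\star)\|^{\frac{q_2-2}{q_2-1}}}.\qquad (\mathrm{II})$$ Then the optimal point $x^\star$ can be found in fixed time $T_{eq}$ by first solving (I) from any $\nu(0)\in\mathbb R^m$ and then solving (II) from any $x(0)\in\mathbb R^n$: there are $T_\nu,T_x<\infty$, independent of $\nu(0)$ and $x(0)$, such that every trajectory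 of (I) satisfies $\nu(t)=\nu^\star$ for all $t\ge T_\nu$, every trajectory of (II) satisfies $x(t)=x^\star$ for all $t\ge T_x$, and $T_{eq}=T_\nu+T_x$ satisfies $$T_{eq}\le\frac{4}{k_3(2-\alpha_1)}+\frac{4}{k_4(\alpha_2-2)}+\frac{4}{k_5(2-\alpha_3)}+\frac{4}{k_6(\alpha_4-2)},$$ where $\alpha_1=2-\frac{p_1-2}{p_1-1}$, $\alpha_2=2-\frac{p_2-2}{p_2-1}$, $\alpha_3=2-\frac{q_1-2}{q_1-1}$, $\alpha_4=2-\frac{q_2-2}{q_2-1}$, $k_3=c_1 2^{\frac{2+3\alpha_1}{4}}\mu_g^{\frac{\alpha_1}{2}}$, $k_4=c_2 2^{\frac{2+3\alpha_2}{4}}\mu_g^{\frac{\alpha_2}{2}}$, $k_5=d_1 2^{\frac{2+3\alpha_3}{4}}\mu_L^{\frac{\alpha_3}{2}}$, $k_6=d_2 2^{\frac{2+3\alpha_4}{4}}\mu_L^{\frac{\alpha_4}{2}}$, and $\mu_g,\mu_L>0$ are the Polyak-Lojasiewicz constants of $-g$ and of $L(\cdot,\nu^\star)$, respectively.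
   Context: $\|\cdot\|$ is the Euclidean norm. $C^{1,1}_{loc}$ denotes continuously differentiable functions with locally Lipschitz gradient. A $C^1$ function $f$ is $\beta_1$-strongly convex if $f(y)\ge f(x)+\nabla f(x)^T(y-x)+\frac{\beta_1}{2}\|x-y\|^2$ for all $x,y$, and $\beta_2$-strongly smooth if $f(y)\le f(x)+\nabla f(x)^T(y-x)+\frac{\beta_2}{2}\|x-y\|^2$ for all $x,y$. The conjugate is $f^*(y)=\sup_{x\in\mathbb R^n}(y^Tx-f(x))$, and $g(\nu)=-\nu^Tb-f^*(-A^T\nu)$. $\nabla_xL(x,\nu)=\nabla f(x)+A^T\nu$. A function $h$ with minimum value $h^\star$ has Polyak-Lojasiewicz constant $\mu>0$ if $\frac12\|\nabla h(y)\|^2\ge\mu(h(y)-h^\star)$ for all $y$; $-g$ and $L(\cdot,\nu^\star)$ are strongly convex and so admit such constants. Convention: the right-hand sides of (I) and (II) are defined to be $0$ where $\nabla g(\nu)=0$, respectively $\nabla_xL(x,\nu^\star)=0$. A trajectory is a solution defined for $t\ge0$. *)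

theory Defs
  imports "HOL-Analysis.Analysis"
begin

definition grad :: "('a::real_inner \<Rightarrow> real) \<Rightarrow> 'a \<Rightarrow> 'a" where
  "grad f x = (THE D. GDERIV f x :> D)"

definition C11_loc :: "('a::real_inner \<Rightarrow> real) \<Rightarrow> bool" where
  "C11_loc f \<longleftrightarrow>
     (\<forall>x. GDERIV f x :> grad f x) \<and> continuous_on UNIV (grad f) \<and>
     (\<forall>x. \<exists>u>0. \<exists>C. C-lipschitz_on (ball x u) (grad f))"

(* The next two notions are meant for differentiable functions only:
   they refer to the total operator grad. *)

definition strongly_convex :: "real \<Rightarrow> ('a::real_inner \<Rightarrow> real) \<Rightarrow> bool" where
  "strongly_convex \<beta> f \<longleftrightarrow>
     (\<forall>x y. f y \<ge> f x + grad f x \<bullet> (y - x) + \<beta> / 2 * (norm (x - y))\<^sup>2)"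

definition strongly_smooth :: "real \<Rightarrow> ('a::real_inner \<Rightarrow> real) \<Rightarrow> bool" where
  "strongly_smooth \<beta> f \<longleftrightarrow>
     (\<forall>x y. f y \<le> f x + grad f x \<bullet> (y - x) + \<beta> / 2 * (norm (x - y))\<^sup>2)"

definition coercive :: "('a::real_normed_vector \<Rightarrow> real) \<Rightarrow> bool" where
  "coercive f \<longleftrightarrow> filterlim f at_top at_infinity"

(* The supremum and infimum below are taken in the reals. They are the intended ones for
   strongly convex f, since then the supremum is over a set bounded above and the infimum
   over a set bounded below. *)

definition conjugate :: "('a::real_inner \<Rightarrow> real) \<Rightarrow> 'a \<Rightarrow> real" where
  "conjugate f y = (SUP x. y \<bullet> x - f x)"

definition lagrangian ::
    "(real^'n \<Rightarrow> real) \<Rightarrow> real^'n^'m \<Rightarrow> real^'m \<Rightarrow> real^'n \<Rightarrow> real^'m \<Rightarrow> real" where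
  "lagrangian f A b x \<nu> = f x + \<nu> \<bullet> (A *v x - b)"

definition dual_function ::
    "(real^'n \<Rightarrow> real) \<Rightarrow> real^'n^'m \<Rightarrow> real^'m \<Rightarrow> real^'m \<Rightarrow> real" where
  "dual_function f A b \<nu> = (INF x. lagrangian f A b x \<nu>)"

definition PL_constant :: "('a::real_inner \<Rightarrow> real) \<Rightarrow> real \<Rightarrow> bool" where
  "PL_constant h \<mu> \<longleftrightarrow> \<mu> > 0 \<and>
     (\<exists>z. is_arg_min h (\<lambda>_. True) z \<and>
          (\<forall>y. 1 / 2 * (norm (grad h y))\<^sup>2 \<ge> \<mu> * (h y - h z)))"

definition fixed_time_field ::
    "real \<Rightarrow> real \<Rightarrow> real \<Rightarrow> real \<Rightarrow> 'a::real_normed_vector \<Rightarrow> 'a" where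
  "fixed_time_field c1 c2 p1 p2 v =
     (if v = 0 then 0
      else c1 *\<^sub>R (v /\<^sub>R norm v powr ((p1 - 2) / (p1 - 1))) +
           c2 *\<^sub>R (v /\<^sub>R norm v powr ((p2 - 2) / (p2 - 1))))"

(* One-sided derivative at t = 0; values at negative times are irrelevant. *)
definition trajectory :: "('a::real_normed_vector \<Rightarrow> 'a) \<Rightarrow> (real \<Rightarrow> 'a) \<Rightarrow> bool" where
  "trajectory F u \<longleftrightarrow> (\<forall>t\<ge>0. (u has_vector_derivative F (u t)) (at t within {0..}))"

end

theory Submission
  imports Defs
begin

text \<open>Both systems are instances of one flow: for a differentiable strongly convex \<open>h\<close> with
  minimizer \<open>z\<close>, the negative gradient is rescaled so that the gap \<open>W = h - h z\<close> decreases at rate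
  \<open>c1 \<parallel>grad h\<parallel> powr \<alpha>1 + c2 \<parallel>grad h\<parallel> powr \<alpha>2\<close> with \<open>\<alpha>1 < 2 < \<alpha>2\<close>. The Polyak-Lojasiewicz
  inequality bounds \<open>\<parallel>grad h\<parallel>\<^sup>2\<close> below by \<open>2 \<mu> W\<close>, which leaves a scalar differential inequality
  with one superlinear and one sublinear damping term. The superlinear term brings \<open>W\<close> down to a
  fixed level in a time independent of the initial value, and the sublinear term makes \<open>W\<close> vanish
  a bounded time later (\<open>fixed_time_extinction\<close>). Splitting at the level \<open>W = sqrt 2\<close> yields exactly
  the claimed bound (\<open>normalized_gradient_flow_fixed_time\<close>).

  It remains to see that \<open>- g\<close> and \<open>L(\<cdot>, \<nu>star)\<close> are such functions with minimizers \<open>\<nu>star\<close> and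
  \<open>xstar\<close>. The Lagrangian differs from \<open>f\<close> by an affine function of \<open>x\<close>, so it inherits strong
  convexity. For the dual function, working directly with the minimizer of the Lagrangian at each
  multiplier gives differentiability by an envelope argument (\<open>GDERIV_dual_function\<close>), and testing
  the infimum at a single gradient step turns the smoothness of \<open>f\<close> and the injectivity of \<open>A\<^sup>T\<close>
  into strong concavity (\<open>strongly_convex_uminus_dual_function\<close>). That \<open>xstar\<close> minimizes
  \<open>L(\<cdot>, \<nu>star)\<close> is strong duality, which follows from the existence of a Lagrange multiplier
  (\<open>constrained_minimizer_minimizes_lagrangian\<close>).\<close>

section \<open>Gradients and strong convexity\<close>

lemma grad_eqI:
  fixes f :: "'a::real_inner \<Rightarrow> real"
  assumes "GDERIV f x :> D"
  shows "grad f x = D"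
  unfolding grad_def
proof (rule the_equality[of "\<lambda>D. GDERIV f x :> D", OF assms])
  fix D' assume "GDERIV f x :> D'"
  with assms have "(\<lambda>h. h \<bullet> D') = (\<lambda>h. h \<bullet> D)"
    unfolding gderiv_def by (rule has_derivative_unique[rotated])
  then have "(D' - D) \<bullet> D' = (D' - D) \<bullet> D" by (rule fun_cong)
  then have "(D' - D) \<bullet> (D' - D) = 0" by (simp add: inner_diff_right)
  then show "D' = D" by simp
qed

lemma grad_eq_zero_at_minimizer:
  fixes h :: "'a::real_inner \<Rightarrow> real"
  assumes "GDERIV h z :> grad h z" and "\<And>y. h z \<le> h y"
  shows "grad h z = 0"
proof -
  have "(\<lambda>v. v \<bullet> grad h z) = (\<lambda>v. 0)"
    using differential_zero_maxmin[of z UNIV h "\<lambda>v. v \<bullet> grad h z"] assms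
    by (simp add: gderiv_def)
  from fun_cong[OF this, of "grad h z"] show ?thesis by simp
qed

lemma GDERIV_imp_continuous_on:
  fixes h :: "'a::real_inner \<Rightarrow> real"
  assumes "\<And>x. GDERIV h x :> D x"
  shows "continuous_on S h"
  using assms unfolding gderiv_def
  by (meson continuous_at_imp_continuous_on has_derivative_continuous)

lemma strongly_convexD:
  "strongly_convex \<beta> h \<Longrightarrow> h x + grad h x \<bullet> (y - x) + \<beta> / 2 * (norm (x - y))\<^sup>2 \<le> h y"
  by (simp add: strongly_convex_def)

text \<open>Outside the ball of radius \<open>2 \<parallel>grad h 0\<parallel> / \<beta>\<close> the quadratic lower bound at the origin
  already exceeds \<open>h 0\<close>, so the minimum over that ball is global.\<close>

lemma strongly_convex_attains_minimum:
  fixes h :: "'a::euclidean_space \<Rightarrow> real"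
  assumes "\<beta> > 0" and sc: "strongly_convex \<beta> h" and "continuous_on UNIV h"
  obtains z where "\<And>y. h z \<le> h y"
proof -
  define R where "R = 2 * norm (grad h 0) / \<beta>"
  have "R \<ge> 0" using \<open>\<beta> > 0\<close> by (simp add: R_def)
  then have ne: "cball (0::'a) R \<noteq> {}" by simp
  have cont: "continuous_on (cball 0 R) h"
    using assms(3) continuous_on_subset by blast
  obtain z where z: "z \<in> cball 0 R" "\<forall>y\<in>cball 0 R. h z \<le> h y"
    using continuous_attains_inf[OF compact_cball ne cont] by blast
  have "h z \<le> h y" for y
  proof (cases "norm y \<le> R")
    case True
    then show ?thesis using z by simp
  next
    case False
    then have "2 * norm (grad h 0) \<le> \<beta> * norm y"
      using \<open>\<beta> > 0\<close> by (simp add: R_def field_simps)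
    then have "2 * norm (grad h 0) * norm y \<le> \<beta> * norm y * norm y"
      by (rule mult_right_mono) simp
    moreover have "- (norm (grad h 0) * norm y) \<le> grad h 0 \<bullet> y"
      using Cauchy_Schwarz_ineq2[of "grad h 0" y] by linarith
    moreover have "h 0 + grad h 0 \<bullet> y + \<beta> / 2 * (norm y)\<^sup>2 \<le> h y"
      using strongly_convexD[OF sc, of 0 y] by simp
    ultimately have "h 0 \<le> h y" by (simp add: power2_eq_square)
    moreover have "h z \<le> h 0" using z \<open>R \<ge> 0\<close> by simp
    ultimately show ?thesis by simp
  qed
  then show ?thesis by (rule that)
qed

lemma strongly_convex_quadratic_growth:
  fixes h :: "'a::real_inner \<Rightarrow> real"
  assumes sc: "strongly_convex \<beta> h" and "GDERIV h z :> grad h z" and "\<And>y. h z \<le> h y"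
  shows "h z + \<beta> / 2 * (norm (z - y))\<^sup>2 \<le> h y"
  using strongly_convexD[OF sc, of z y] grad_eq_zero_at_minimizer[OF assms(2,3)] by simp

text \<open>Minimizing the quadratic lower bound at \<open>y\<close> over the second point gives
  \<open>h y - \<parallel>grad h y\<parallel>\<^sup>2 / (2 \<beta>)\<close>, so the modulus of convexity is itself an
  admissible constant.\<close>

lemma strongly_convex_imp_PL_constant:
  fixes h :: "'a::real_inner \<Rightarrow> real"
  assumes "\<beta> > 0" and sc: "strongly_convex \<beta> h" and min: "\<And>y. h z \<le> h y"
  shows "PL_constant h \<beta>"
proof -
  have "\<beta> * (h y - h z) \<le> 1 / 2 * (norm (grad h y))\<^sup>2" for y
  proof -
    let ?d = "\<beta> *\<^sub>R (z - y) + grad h y"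
    have "0 \<le> ?d \<bullet> ?d" by simp
    also have "\<dots> = \<beta>\<^sup>2 * (norm (y - z))\<^sup>2 + 2 * \<beta> * (grad h y \<bullet> (z - y)) + (norm (grad h y))\<^sup>2"
      unfolding power2_norm_eq_inner
      by (simp add: inner_add_left inner_add_right inner_diff_left inner_diff_right
          inner_commute power2_eq_square algebra_simps)
    finally have sq: "0 \<le> \<beta>\<^sup>2 * (norm (y - z))\<^sup>2 + 2 * \<beta> * (grad h y \<bullet> (z - y)) + (norm (grad h y))\<^sup>2" .
    have "\<beta> * (h y + grad h y \<bullet> (z - y) + \<beta> / 2 * (norm (y - z))\<^sup>2) \<le> \<beta> * h z"
      using strongly_convexD[OF sc, of y z] \<open>\<beta> > 0\<close> by simp
    with sq show ?thesis by (simp add: algebra_simps power2_eq_square)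
  qed
  then show ?thesis
    unfolding PL_constant_def is_arg_min_linorder using \<open>\<beta> > 0\<close> min by blast
qed

section \<open>Fixed-time extinction for a scalar differential inequality\<close>

text \<open>By the chain rule \<open>W powr (1 - \<rho>) / (1 - \<rho>)\<close> has derivative \<open>W powr (- \<rho>) * W'\<close>, which is
  at most \<open>- k\<close>. The statement covers both signs of \<open>1 - \<rho>\<close>: for \<open>\<rho> > 1\<close> it bounds the time spent at large values
  uniformly in the initial value, for \<open>\<rho> < 1\<close> it forces extinction.\<close>

lemma powr_decay:
  fixes W W' :: "real \<Rightarrow> real"
  assumes "s \<le> t" and "\<rho> \<noteq> 1"
    and cont: "continuous_on {s..t} W"
    and deriv: "\<And>x. s < x \<Longrightarrow> x < t \<Longrightarrow> (W has_real_derivative W' x) (at x)"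
    and decay: "\<And>x. s < x \<Longrightarrow> x < t \<Longrightarrow> W' x \<le> - (k * W x powr \<rho>)"
    and pos: "\<And>x. s \<le> x \<Longrightarrow> x \<le> t \<Longrightarrow> W x > 0"
  shows "W t powr (1 - \<rho>) / (1 - \<rho>) \<le> W s powr (1 - \<rho>) / (1 - \<rho>) - k * (t - s)"
proof -
  let ?\<phi> = "\<lambda>x. W x powr (1 - \<rho>) / (1 - \<rho>) + k * x"
  have "?\<phi> t \<le> ?\<phi> s"
  proof (rule DERIV_nonpos_imp_decreasing_open[OF \<open>s \<le> t\<close>])
    have "\<forall>x\<in>{s..t}. W x \<noteq> 0"
      using pos by (metis atLeastAtMost_iff less_irrefl)
    then show "continuous_on {s..t} ?\<phi>"
      using \<open>\<rho> \<noteq> 1\<close> by (intro continuous_intros cont) auto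
  next
    fix x assume x: "s < x" "x < t"
    then have Wx: "W x > 0" using pos by simp
    have "((\<lambda>x. W x powr (1 - \<rho>)) has_real_derivative (1 - \<rho>) * W x powr (- \<rho>) * W' x) (at x)"
      using DERIV_fun_powr[OF deriv[OF x] Wx, of "1 - \<rho>"] by simp
    from DERIV_add[OF DERIV_cdivide[OF this, of "1 - \<rho>"] DERIV_cmult_Id[of k]]
    have "(?\<phi> has_real_derivative (W x powr (- \<rho>) * W' x + k)) (at x)"
      using \<open>\<rho> \<noteq> 1\<close> by simp
    moreover have "W x powr (- \<rho>) * W' x \<le> W x powr (- \<rho>) * (- (k * W x powr \<rho>))"
      by (rule mult_left_mono[OF decay[OF x]]) simp
    then have "W x powr (- \<rho>) * W' x + k \<le> 0"
      using Wx by (simp add: powr_minus field_simps)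
    ultimately show "\<exists>y. (?\<phi> has_real_derivative y) (at x) \<and> y \<le> 0" by blast
  qed
  then show ?thesis by (simp add: algebra_simps)
qed

text \<open>A threshold \<open>\<omega>\<close> separates two phases: the superlinear term brings \<open>W\<close> below \<open>\<omega>\<close> from any
  height within the first summand of the time bound, and the sublinear term then brings it from
  \<open>\<omega>\<close> to zero within the second.\<close>

lemma fixed_time_extinction:
  fixes W W' :: "real \<Rightarrow> real"
  assumes "a > 0" "b > 0" "r < 1" "1 < s" "\<omega> > 0"
    and deriv: "\<And>t. t \<ge> 0 \<Longrightarrow> (W has_real_derivative W' t) (at t within {0..})"
    and nonneg: "\<And>t. t \<ge> 0 \<Longrightarrow> W t \<ge> 0"
    and decay: "\<And>t. t \<ge> 0 \<Longrightarrow> W' t \<le> - a * W t powr r - b * W t powr s"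
    and late: "\<omega> powr (1 - s) / (b * (s - 1)) + \<omega> powr (1 - r) / (a * (1 - r)) \<le> t"
  shows "W t = 0"
proof (rule ccontr)
  define T1 where "T1 = \<omega> powr (1 - s) / (b * (s - 1))"
  have T1: "T1 > 0" using assms(1-5) by (simp add: T1_def)
  have T2: "\<omega> powr (1 - r) / (a * (1 - r)) > 0" using assms(1-5) by simp
  have t: "T1 \<le> t" "0 \<le> t" using late T1 T2 by (simp_all add: T1_def)
  have cont: "continuous_on {x..y} W" if "0 \<le> x" for x y
  proof (rule continuous_on_subset)
    show "continuous_on {0..} W"
      using deriv by (meson DERIV_continuous_on atLeast_iff)
    show "{x..y} \<subseteq> {0..}" using that by auto
  qed
  have deriv': "(W has_real_derivative W' x) (at x)" if "0 < x" for x
    using deriv[of x] at_within_interior[of x "{0..}"] that by (simp add: interior_real_atLeast)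
  have decay_r: "W' x \<le> - (a * W x powr r)" and decay_s: "W' x \<le> - (b * W x powr s)"
    if "0 < x" for x
  proof -
    have "0 \<le> a * W x powr r" "0 \<le> b * W x powr s" using assms(1,2) by simp_all
    then show "W' x \<le> - (a * W x powr r)" "W' x \<le> - (b * W x powr s)"
      using decay[of x] that by linarith+
  qed
  have mono: "W y \<le> W x" if "0 \<le> x" "x \<le> y" for x y
  proof (rule DERIV_nonpos_imp_decreasing_open[OF \<open>x \<le> y\<close> _ cont[OF \<open>0 \<le> x\<close>]])
    fix v assume v: "x < v" "v < y"
    then have "v > 0" using that by simp
    moreover have "0 \<le> a * W v powr r" using assms(1) by simp
    ultimately have "W' v \<le> 0" using decay_r[of v] by linarith
    then show "\<exists>y. (W has_real_derivative y) (at v) \<and> y \<le> 0"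
      using deriv'[OF \<open>v > 0\<close>] by blast
  qed
  assume "W t \<noteq> 0"
  then have "W t > 0" using nonneg[OF t(2)] by simp
  then have pos: "W x > 0" if "0 \<le> x" "x \<le> t" for x
    using mono[OF that] by simp
  have "W T1 \<le> \<omega>"
  proof (rule ccontr)
    assume "\<not> W T1 \<le> \<omega>"
    then have less: "W T1 powr (1 - s) < \<omega> powr (1 - s)"
      using assms(4,5) by (intro powr_less_mono2_neg) auto
    have "W T1 powr (1 - s) / (1 - s) \<le> W 0 powr (1 - s) / (1 - s) - b * (T1 - 0)"
      by (rule powr_decay[where W' = W']) (use T1 t assms(4) in \<open>auto intro!: cont deriv' decay_s pos\<close>)
    also have "\<dots> \<le> - b * T1" using assms(4) by (simp add: divide_nonneg_neg)
    also have "\<dots> = \<omega> powr (1 - s) / (1 - s)"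
      using assms(2,4) by (simp add: T1_def field_simps)
    finally show False using divide_strict_right_mono_neg[OF less, of "1 - s"] assms(4) by simp
  qed
  moreover have "W T1 > 0" using pos T1 t by simp
  ultimately have "W T1 powr (1 - r) \<le> \<omega> powr (1 - r)"
    using assms(3) by (intro powr_mono2) auto
  then have start: "W T1 powr (1 - r) / (1 - r) \<le> \<omega> powr (1 - r) / (1 - r)"
    using assms(3) by (simp add: divide_right_mono)
  have "W t powr (1 - r) / (1 - r) \<le> W T1 powr (1 - r) / (1 - r) - a * (t - T1)"
    by (rule powr_decay[where W' = W']) (use T1 t assms(3) in \<open>auto intro!: cont deriv' decay_r pos\<close>)
  also have "\<dots> \<le> \<omega> powr (1 - r) / (1 - r) - a * (\<omega> powr (1 - r) / (a * (1 - r)))"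
  proof -
    have "a * (\<omega> powr (1 - r) / (a * (1 - r))) \<le> a * (t - T1)"
      using late assms(1) by (intro mult_left_mono) (simp_all add: T1_def)
    with start show ?thesis by linarith
  qed
  also have "\<dots> = 0" using assms(1,3) by simp
  finally have "W t powr (1 - r) \<le> 0" using assms(3) by (simp add: divide_le_0_iff)
  with \<open>W t > 0\<close> show False by simp
qed

section \<open>Fixed-time convergence of the normalized gradient flow\<close>

lemma inner_fixed_time_field:
  fixes v :: "'a::real_inner"
  shows "v \<bullet> fixed_time_field c1 c2 p1 p2 v =
    c1 * norm v powr (2 - (p1 - 2) / (p1 - 1)) + c2 * norm v powr (2 - (p2 - 2) / (p2 - 1))"
proof (cases "v = 0")
  case False
  then have "norm v powr (2 - e) = (norm v)\<^sup>2 / norm v powr e" for e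
    by (simp add: powr_diff)
  with False show ?thesis
    by (simp add: fixed_time_field_def inner_add_right power2_norm_eq_inner divide_inverse ac_simps)
qed (simp add: fixed_time_field_def)

lemma fixed_time_field_uminus:
  "fixed_time_field c1 c2 p1 p2 (- v) = - fixed_time_field c1 c2 p1 p2 v"
  by (simp add: fixed_time_field_def)

text \<open>The Lyapunov function is the gap \<open>W = h - h z\<close>, for which the Polyak-Lojasiewicz inequality
  gives \<open>W' \<le> - c1 (2 \<mu> W) powr (\<alpha>1 / 2) - c2 (2 \<mu> W) powr (\<alpha>2 / 2)\<close>. The two summands of the
  stated time bound the phases spent below and above the threshold \<open>\<omega> = sqrt 2\<close>, respectively.
  The choice of the threshold matters: it is the level at which \<open>W\<^sup>2 / 2 = 1\<close>, and with \<open>\<omega> = 1\<close>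
  the bound for the upper phase would exceed \<open>4 / (k2 (\<alpha>2 - 2))\<close>.\<close>

lemma normalized_gradient_flow_fixed_time:
  fixes h :: "'a::real_inner \<Rightarrow> real"
  assumes D: "\<And>x. GDERIV h x :> grad h x"
    and "\<beta> > 0" and sc: "strongly_convex \<beta> h" and min: "\<And>y. h z \<le> h y"
    and PL: "PL_constant h \<mu>"
    and "c1 > 0" "c2 > 0" "p1 > 2" "1 < p2" "p2 < 2"
    and \<alpha>1: "\<alpha>1 = 2 - (p1 - 2) / (p1 - 1)" and \<alpha>2: "\<alpha>2 = 2 - (p2 - 2) / (p2 - 1)"
    and k1: "k1 = c1 * 2 powr ((2 + 3 * \<alpha>1) / 4) * \<mu> powr (\<alpha>1 / 2)"
    and k2: "k2 = c2 * 2 powr ((2 + 3 * \<alpha>2) / 4) * \<mu> powr (\<alpha>2 / 2)"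
    and traj: "trajectory (\<lambda>y. - fixed_time_field c1 c2 p1 p2 (grad h y)) u"
    and late: "4 / (k1 * (2 - \<alpha>1)) + 4 / (k2 * (\<alpha>2 - 2)) \<le> t"
  shows "u t = z"
proof -
  have \<mu>: "\<mu> > 0" using PL by (simp add: PL_constant_def)
  have PL': "2 * \<mu> * (h y - h z) \<le> (norm (grad h y))\<^sup>2" for y
  proof -
    obtain z' where z': "\<forall>y. h z' \<le> h y" "\<forall>y. \<mu> * (h y - h z') \<le> 1 / 2 * (norm (grad h y))\<^sup>2"
      using PL by (auto simp: PL_constant_def is_arg_min_linorder)
    then have "h z' = h z" using min by (simp add: antisym)
    with z'(2) show ?thesis by (simp add: algebra_simps)
  qed
  have a1: "0 < \<alpha>1" "\<alpha>1 < 2" using assms(8) by (simp_all add: \<alpha>1 field_simps)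
  have a2: "2 < \<alpha>2" using assms(9,10) by (simp add: \<alpha>2 field_simps)
  let ?W = "\<lambda>t. h (u t) - h z"
  let ?W' = "\<lambda>t. - (c1 * norm (grad h (u t)) powr \<alpha>1 + c2 * norm (grad h (u t)) powr \<alpha>2)"
  have PL_powr: "(2 * \<mu>) powr (\<alpha> / 2) * (h y - h z) powr (\<alpha> / 2) \<le> norm (grad h y) powr \<alpha>"
    if "0 < \<alpha>" for \<alpha> y
  proof -
    have "(2 * \<mu> * (h y - h z)) powr (\<alpha> / 2) \<le> ((norm (grad h y))\<^sup>2) powr (\<alpha> / 2)"
      using PL' \<mu> min that by (intro powr_mono2) simp_all
    moreover have "((norm (grad h y))\<^sup>2) powr (\<alpha> / 2) = norm (grad h y) powr \<alpha>"
    proof (cases "grad h y = 0")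
      case False
      then have sq: "(norm (grad h y))\<^sup>2 = norm (grad h y) powr 2" by simp
      show ?thesis unfolding sq powr_powr by simp
    qed simp
    ultimately show ?thesis using \<mu> min by (simp add: powr_mult)
  qed
  \<comment> \<open>The factor \<open>\<omega> powr (1 - \<alpha> / 2)\<close> from the phase bounds accounts for the difference between
    the powers of two in \<open>k1\<close>, \<open>k2\<close> and in the decay rates of \<open>W\<close>.\<close>
  have rate: "c * 2 powr ((2 + 3 * \<alpha>) / 4) * \<mu> powr (\<alpha> / 2) * (sqrt 2) powr (1 - \<alpha> / 2)
      = 2 * (c * (2 * \<mu>) powr (\<alpha> / 2))" for c \<alpha> :: real
  proof -
    have "2 powr ((2 + 3 * \<alpha>) / 4) * (sqrt 2) powr (1 - \<alpha> / 2)
        = 2 powr ((2 + 3 * \<alpha>) / 4 + 1 / 2 * (1 - \<alpha> / 2))"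
      by (simp add: powr_half_sqrt[symmetric] powr_powr powr_add)
    also have "(2 + 3 * \<alpha>) / 4 + 1 / 2 * (1 - \<alpha> / 2) = 1 + \<alpha> / 2" by (simp add: field_simps)
    also have "(2::real) powr (1 + \<alpha> / 2) = 2 * 2 powr (\<alpha> / 2)" by (simp add: powr_add)
    finally show ?thesis using \<mu> by (simp add: powr_mult ac_simps)
  qed
  have phase: "s / (k * s / 2 * (e / 2)) = 4 / (k * e)" if "s \<noteq> 0" for k s e :: real
    using that by (cases "k = 0"; cases "e = 0") (simp_all add: field_simps)
  have phase1: "(sqrt 2) powr (1 - \<alpha>1 / 2) / (c1 * (2 * \<mu>) powr (\<alpha>1 / 2) * (1 - \<alpha>1 / 2))
      = 4 / (k1 * (2 - \<alpha>1))"
  proof -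
    have m: "c1 * (2 * \<mu>) powr (\<alpha>1 / 2) = k1 * (sqrt 2) powr (1 - \<alpha>1 / 2) / 2"
      using rate[of c1 \<alpha>1] unfolding k1 by linarith
    have e: "1 - \<alpha>1 / 2 = (2 - \<alpha>1) / 2" by simp
    show ?thesis unfolding m unfolding e by (rule phase) simp
  qed
  have phase2: "(sqrt 2) powr (1 - \<alpha>2 / 2) / (c2 * (2 * \<mu>) powr (\<alpha>2 / 2) * (\<alpha>2 / 2 - 1))
      = 4 / (k2 * (\<alpha>2 - 2))"
  proof -
    have m: "c2 * (2 * \<mu>) powr (\<alpha>2 / 2) = k2 * (sqrt 2) powr (1 - \<alpha>2 / 2) / 2"
      using rate[of c2 \<alpha>2] unfolding k2 by linarith
    have e: "\<alpha>2 / 2 - 1 = (\<alpha>2 - 2) / 2" by simp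
    show ?thesis unfolding m unfolding e by (rule phase) simp
  qed
  have "?W t = 0"
  proof (rule fixed_time_extinction[where W = ?W and W' = ?W' and t = t
        and a = "c1 * (2 * \<mu>) powr (\<alpha>1 / 2)" and b = "c2 * (2 * \<mu>) powr (\<alpha>2 / 2)"
        and r = "\<alpha>1 / 2" and s = "\<alpha>2 / 2" and \<omega> = "sqrt 2"])
    fix t :: real assume "t \<ge> 0"
    let ?F = "fixed_time_field c1 c2 p1 p2 (grad h (u t))"
    have "(u has_derivative (\<lambda>x. x *\<^sub>R (- ?F))) (at t within {0..})"
      using traj \<open>t \<ge> 0\<close> by (simp add: trajectory_def has_vector_derivative_def)
    from has_derivative_compose[OF this D[of "u t", unfolded gderiv_def]]
    have "((\<lambda>t. h (u t)) has_derivative (\<lambda>x. x *\<^sub>R (- ?F) \<bullet> grad h (u t))) (at t within {0..})" .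
    moreover have "(\<lambda>x. x *\<^sub>R (- ?F) \<bullet> grad h (u t)) = (*) (?W' t)"
      using inner_fixed_time_field[of "grad h (u t)" c1 c2 p1 p2]
      by (auto simp: \<alpha>1 \<alpha>2 inner_commute algebra_simps)
    ultimately have "((\<lambda>t. h (u t)) has_real_derivative ?W' t) (at t within {0..})"
      by (simp add: has_field_derivative_def)
    from DERIV_diff[OF this DERIV_const[of "h z"]]
    show "(?W has_real_derivative ?W' t) (at t within {0..})" by simp
    show "?W t \<ge> 0" using min by simp
    have "c1 * ((2 * \<mu>) powr (\<alpha>1 / 2) * ?W t powr (\<alpha>1 / 2)) \<le> c1 * norm (grad h (u t)) powr \<alpha>1"
      "c2 * ((2 * \<mu>) powr (\<alpha>2 / 2) * ?W t powr (\<alpha>2 / 2)) \<le> c2 * norm (grad h (u t)) powr \<alpha>2"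
      using PL_powr a1 a2 assms(6,7) by (auto intro!: mult_left_mono)
    then show "?W' t \<le> - (c1 * (2 * \<mu>) powr (\<alpha>1 / 2)) * ?W t powr (\<alpha>1 / 2)
        - (c2 * (2 * \<mu>) powr (\<alpha>2 / 2)) * ?W t powr (\<alpha>2 / 2)"
      by (simp add: mult.assoc)
  next
    show "(sqrt 2) powr (1 - \<alpha>2 / 2) / (c2 * (2 * \<mu>) powr (\<alpha>2 / 2) * (\<alpha>2 / 2 - 1)) +
      (sqrt 2) powr (1 - \<alpha>1 / 2) / (c1 * (2 * \<mu>) powr (\<alpha>1 / 2) * (1 - \<alpha>1 / 2)) \<le> t"
      using late phase1 phase2 by simp
  qed (use a1 a2 assms(6,7) \<mu> in simp_all)
  moreover have "h z + \<beta> / 2 * (norm (z - u t))\<^sup>2 \<le> h (u t)"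
    by (rule strongly_convex_quadratic_growth[OF sc D min])
  ultimately have "\<beta> / 2 * (norm (z - u t))\<^sup>2 \<le> 0" by simp
  then show ?thesis using \<open>\<beta> > 0\<close> by (simp add: mult_le_0_iff)
qed

section \<open>The Lagrangian and the dual function\<close>

lemma inner_matrix_transpose:
  fixes A :: "real^'n^'m"
  shows "\<nu> \<bullet> (A *v x) = (transpose A *v \<nu>) \<bullet> x"
  by (simp add: dot_lmul_matrix[symmetric] transpose_matrix_vector)

lemma lagrangian_alt:
  "lagrangian f A b x \<nu> = f x + (transpose A *v \<nu>) \<bullet> x - \<nu> \<bullet> b"
  by (simp add: lagrangian_def inner_diff_right inner_matrix_transpose)

lemma GDERIV_lagrangian:
  assumes "GDERIV f x :> D"
  shows "GDERIV (\<lambda>x. lagrangian f A b x \<nu>) x :> D + transpose A *v \<nu>"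
proof -
  have "GDERIV (\<lambda>x. (transpose A *v \<nu>) \<bullet> x - \<nu> \<bullet> b) x :> transpose A *v \<nu>"
    unfolding gderiv_def by (auto intro!: derivative_eq_intros simp: inner_commute)
  from GDERIV_add[OF assms this] show ?thesis
    by (simp add: lagrangian_alt add_diff_eq)
qed

lemma grad_lagrangian:
  assumes "\<And>x. GDERIV f x :> grad f x"
  shows "grad (\<lambda>x. lagrangian f A b x \<nu>) x = grad f x + transpose A *v \<nu>"
  by (rule grad_eqI[OF GDERIV_lagrangian[OF assms]])

lemma strongly_convex_lagrangian:
  assumes "\<And>x. GDERIV f x :> grad f x" and "strongly_convex \<beta> f"
  shows "strongly_convex \<beta> (\<lambda>x. lagrangian f A b x \<nu>)"
  using assms(2) unfolding strongly_convex_def grad_lagrangian[OF assms(1)]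
  by (simp add: lagrangian_alt inner_add_left inner_diff_right algebra_simps)

lemma dual_function_eq_lagrangian:
  assumes "\<And>y. lagrangian f A b x \<nu> \<le> lagrangian f A b y \<nu>"
  shows "dual_function f A b \<nu> = lagrangian f A b x \<nu>"
  unfolding dual_function_def by (rule cInf_eq_minimum) (use assms in auto)

lemma lagrangian_minimizer_exists:
  fixes f :: "real^'n \<Rightarrow> real"
  assumes D: "\<And>x. GDERIV f x :> grad f x" and "\<beta> > 0" and sc: "strongly_convex \<beta> f"
  shows "\<exists>x. (\<forall>y. lagrangian f A b x \<nu> \<le> lagrangian f A b y \<nu>) \<and>
    grad f x = - (transpose A *v \<nu>) \<and> dual_function f A b \<nu> = lagrangian f A b x \<nu>"
proof -
  have DL: "GDERIV (\<lambda>x. lagrangian f A b x \<nu>) x :> grad (\<lambda>x. lagrangian f A b x \<nu>) x" for x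
    unfolding grad_lagrangian[OF D] by (rule GDERIV_lagrangian[OF D])
  obtain x where x: "\<And>y. lagrangian f A b x \<nu> \<le> lagrangian f A b y \<nu>"
    using strongly_convex_attains_minimum[OF \<open>\<beta> > 0\<close> strongly_convex_lagrangian[OF D sc]
        GDERIV_imp_continuous_on[OF DL]] by blast
  have "grad f x = - (transpose A *v \<nu>)"
    using grad_eq_zero_at_minimizer[OF DL x] unfolding grad_lagrangian[OF D]
    by (simp add: add_eq_0_iff2)
  then show ?thesis using x dual_function_eq_lagrangian[OF x] by blast
qed

lemma dual_function_le_lagrangian:
  fixes f :: "real^'n \<Rightarrow> real"
  assumes "\<And>x. GDERIV f x :> grad f x" and "\<beta> > 0" and "strongly_convex \<beta> f"
  shows "dual_function f A b \<nu> \<le> lagrangian f A b x \<nu>"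
  using lagrangian_minimizer_exists[OF assms, of A b \<nu>] by auto

lemma strongly_convex_gradient_monotone:
  assumes "strongly_convex \<beta> f"
  shows "\<beta> * (norm (x - y))\<^sup>2 \<le> (grad f x - grad f y) \<bullet> (x - y)"
  using strongly_convexD[OF assms, of x y] strongly_convexD[OF assms, of y x]
  by (simp add: norm_minus_commute inner_diff_left inner_diff_right)

text \<open>Envelope theorem. If \<open>x\<close> minimizes the Lagrangian at \<open>\<nu>\<close> and \<open>x'\<close> at \<open>\<nu>'\<close>, each of them
  is a competitor at the other multiplier, which traps the linearization error of the dual
  function at \<open>\<nu>\<close> between \<open>0\<close> and \<open>(\<nu>' - \<nu>) \<bullet> A (x' - x)\<close>. Strong convexity makes the minimizer
  Lipschitz in the multiplier, so this error is quadratic in \<open>\<nu>' - \<nu>\<close>.\<close>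

lemma GDERIV_dual_function:
  fixes f :: "real^'n \<Rightarrow> real" and A :: "real^'n^'m"
  assumes D: "\<And>x. GDERIV f x :> grad f x" and "\<beta> > 0" and sc: "strongly_convex \<beta> f"
    and x: "grad f x = - (transpose A *v \<nu>)" "dual_function f A b \<nu> = lagrangian f A b x \<nu>"
  shows "GDERIV (dual_function f A b) \<nu> :> A *v x - b"
proof -
  let ?g = "dual_function f A b"
  obtain K where K: "K > 0" "\<And>v. norm (A *v v) \<le> K * norm v"
    using bounded_linear.pos_bounded[OF matrix_vector_mul_bounded_linear[of A]]
    by (metis mult.commute)
  obtain K' where K': "K' > 0" "\<And>v. norm (transpose A *v v) \<le> K' * norm v"
    using bounded_linear.pos_bounded[OF matrix_vector_mul_bounded_linear[of "transpose A"]]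
    by (metis mult.commute)
  define C where "C = K * K' / \<beta>"
  have C: "C > 0" using K K' \<open>\<beta> > 0\<close> by (simp add: C_def)
  have err: "\<bar>?g \<nu>' - ?g \<nu> - (\<nu>' - \<nu>) \<bullet> (A *v x - b)\<bar> \<le> C * (norm (\<nu>' - \<nu>))\<^sup>2" for \<nu>'
  proof -
    obtain x' where x': "grad f x' = - (transpose A *v \<nu>')" "?g \<nu>' = lagrangian f A b x' \<nu>'"
      using lagrangian_minimizer_exists[OF D \<open>\<beta> > 0\<close> sc] by blast
    let ?d = "\<nu>' - \<nu>"
    have "\<beta> * norm (x - x') * norm (x - x') \<le> (transpose A *v ?d) \<bullet> (x - x')"
      using strongly_convex_gradient_monotone[OF sc, of x x'] x x'
      by (simp add: matrix_vector_mult_diff_distrib power2_eq_square)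
    also have "\<dots> \<le> norm (transpose A *v ?d) * norm (x - x')" by (rule norm_cauchy_schwarz)
    also have "\<dots> \<le> K' * norm ?d * norm (x - x')" by (intro mult_right_mono K') simp
    finally have "\<beta> * norm (x - x') \<le> K' * norm ?d"
      using K'(1) by (cases "x = x'") simp_all
    then have lip: "norm (x - x') \<le> K' * norm ?d / \<beta>"
      using \<open>\<beta> > 0\<close> by (simp add: field_simps)
    have le1: "?g \<nu>' \<le> lagrangian f A b x \<nu>'" and le2: "?g \<nu> \<le> lagrangian f A b x' \<nu>"
      by (rule dual_function_le_lagrangian[OF D \<open>\<beta> > 0\<close> sc])+
    have "?g \<nu>' - ?g \<nu> - ?d \<bullet> (A *v x - b) \<le> 0"
      using le1 x(2) by (simp add: lagrangian_def inner_diff_left)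
    moreover have "- (?d \<bullet> (A *v (x - x'))) \<le> ?g \<nu>' - ?g \<nu> - ?d \<bullet> (A *v x - b)"
      using le2 x'(2)
      by (simp add: lagrangian_def inner_diff_left inner_diff_right matrix_vector_mult_diff_distrib)
    moreover have "?d \<bullet> (A *v (x - x')) \<le> C * (norm ?d)\<^sup>2"
    proof -
      have "?d \<bullet> (A *v (x - x')) \<le> norm ?d * norm (A *v (x - x'))" by (rule norm_cauchy_schwarz)
      also have "\<dots> \<le> norm ?d * (K * norm (x - x'))" by (intro mult_left_mono K) simp
      also have "\<dots> \<le> norm ?d * (K * (K' * norm ?d / \<beta>))"
        using lip K(1) by (intro mult_left_mono) simp_all
      finally show ?thesis by (simp add: C_def power2_eq_square ac_simps)
    qed
    ultimately show ?thesis by linarith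
  qed
  show ?thesis
    unfolding gderiv_def has_derivative_at_alt
  proof (intro conjI allI impI bounded_linear_inner_left)
    fix e :: real assume "e > 0"
    have "norm (?g \<nu>' - ?g \<nu> - (\<nu>' - \<nu>) \<bullet> (A *v x - b)) \<le> e * norm (\<nu>' - \<nu>)"
      if "norm (\<nu>' - \<nu>) < e / C" for \<nu>'
    proof -
      have "C * norm (\<nu>' - \<nu>) \<le> e" using that C by (simp add: field_simps)
      then have "C * norm (\<nu>' - \<nu>) * norm (\<nu>' - \<nu>) \<le> e * norm (\<nu>' - \<nu>)"
        by (rule mult_right_mono) simp
      with err[of \<nu>'] show ?thesis by (simp add: power2_eq_square)
    qed
    then show "\<exists>d>0. \<forall>\<nu>'. norm (\<nu>' - \<nu>) < d \<longrightarrow>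
        norm (?g \<nu>' - ?g \<nu> - (\<nu>' - \<nu>) \<bullet> (A *v x - b)) \<le> e * norm (\<nu>' - \<nu>)"
      using \<open>e > 0\<close> C by (intro exI[of _ "e / C"]) simp
  qed
qed

lemma GDERIV_grad_dual_function:
  fixes f :: "real^'n \<Rightarrow> real" and A :: "real^'n^'m"
  assumes D: "\<And>x. GDERIV f x :> grad f x" and "\<beta> > 0" and sc: "strongly_convex \<beta> f"
  shows "GDERIV (dual_function f A b) \<nu> :> grad (dual_function f A b) \<nu>"
  using lagrangian_minimizer_exists[OF assms, of A b \<nu>] GDERIV_dual_function[OF assms]
    grad_eqI by metis

text \<open>Smoothness of \<open>f\<close> turns into strong concavity of the dual function: at the multiplier
  \<open>\<nu> + d\<close> the gradient step \<open>x - A\<^sup>T d / \<beta>\<close> from the minimizer \<open>x\<close> at \<open>\<nu>\<close> is a competitor whose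
  Lagrangian lies at least \<open>\<parallel>A\<^sup>T d\<parallel>\<^sup>2 / (2 \<beta>)\<close> below the linearization, and \<open>A\<^sup>T\<close> is bounded below
  by \<open>\<sigma>\<close>.\<close>

lemma strongly_convex_uminus_dual_function:
  fixes f :: "real^'n \<Rightarrow> real" and A :: "real^'n^'m"
  assumes D: "\<And>x. GDERIV f x :> grad f x" and "\<gamma> > 0" and sc: "strongly_convex \<gamma> f"
    and "\<beta> > 0" and ss: "strongly_smooth \<beta> f"
    and "\<sigma> \<ge> 0" and \<sigma>: "\<And>\<nu>. \<sigma> * norm \<nu> \<le> norm (transpose A *v \<nu>)"
  shows "strongly_convex (\<sigma>\<^sup>2 / \<beta>) (\<lambda>\<nu>. - dual_function f A b \<nu>)"
  unfolding strongly_convex_def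
proof (intro allI)
  fix \<nu> \<nu>' :: "real^'m"
  let ?g = "dual_function f A b"
  obtain x where x: "grad f x = - (transpose A *v \<nu>)" "?g \<nu> = lagrangian f A b x \<nu>"
    using lagrangian_minimizer_exists[OF D \<open>\<gamma> > 0\<close> sc] by blast
  have grad: "grad (\<lambda>\<nu>. - ?g \<nu>) \<nu> = - (A *v x - b)"
    by (intro grad_eqI GDERIV_minus GDERIV_dual_function[OF D \<open>\<gamma> > 0\<close> sc x])
  define d where "d = \<nu>' - \<nu>"
  define w where "w = transpose A *v d"
  define y where "y = x - (1 / \<beta>) *\<^sub>R w"
  have \<nu>': "\<nu>' = \<nu> + d" by (simp add: d_def)
  have ww: "\<sigma>\<^sup>2 * (norm d)\<^sup>2 \<le> w \<bullet> w"
  proof -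
    have "(\<sigma> * norm d)\<^sup>2 \<le> (norm w)\<^sup>2"
      using \<sigma>[of d] \<open>\<sigma> \<ge> 0\<close> by (intro power_mono) (simp_all add: w_def)
    then show ?thesis by (simp add: power_mult_distrib power2_norm_eq_inner)
  qed
  have "?g \<nu>' \<le> lagrangian f A b y \<nu>'"
    by (rule dual_function_le_lagrangian[OF D \<open>\<gamma> > 0\<close> sc])
  also have "\<dots> = f y + (transpose A *v \<nu>) \<bullet> y + w \<bullet> y - \<nu>' \<bullet> b"
    by (simp add: lagrangian_alt \<nu>' w_def matrix_vector_right_distrib inner_add_left)
  also have "f y \<le> f x + grad f x \<bullet> (y - x) + \<beta> / 2 * (norm (x - y))\<^sup>2"
    using ss by (simp add: strongly_smooth_def)
  also have "(norm (x - y))\<^sup>2 = (w \<bullet> w) / \<beta>\<^sup>2"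
    unfolding y_def by (simp add: power_divide power2_norm_eq_inner)
  also have "f x + grad f x \<bullet> (y - x) + \<beta> / 2 * ((w \<bullet> w) / \<beta>\<^sup>2) + (transpose A *v \<nu>) \<bullet> y
      + w \<bullet> y - \<nu>' \<bullet> b = ?g \<nu> + d \<bullet> (A *v x - b) - (w \<bullet> w) / (2 * \<beta>)"
  proof -
    have "w \<bullet> y = d \<bullet> (A *v x) - (w \<bullet> w) / \<beta>"
      by (simp add: y_def inner_diff_right inner_matrix_transpose w_def)
    moreover have "\<beta> / 2 * ((w \<bullet> w) / \<beta>\<^sup>2) = (w \<bullet> w) / \<beta> - (w \<bullet> w) / (2 * \<beta>)"
      using \<open>\<beta> > 0\<close> by (simp add: field_simps power2_eq_square)
    ultimately show ?thesis
      by (simp add: x lagrangian_alt \<nu>' inner_diff_right inner_add_left)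
  qed
  finally have "?g \<nu>' \<le> ?g \<nu> + d \<bullet> (A *v x - b) - (w \<bullet> w) / (2 * \<beta>)" by simp
  moreover have "\<sigma>\<^sup>2 / \<beta> / 2 * (norm d)\<^sup>2 \<le> (w \<bullet> w) / (2 * \<beta>)"
    using ww \<open>\<beta> > 0\<close> by (simp add: field_simps)
  ultimately show "- ?g \<nu> + grad (\<lambda>\<nu>. - ?g \<nu>) \<nu> \<bullet> (\<nu>' - \<nu>) + \<sigma>\<^sup>2 / \<beta> / 2 * (norm (\<nu> - \<nu>'))\<^sup>2
      \<le> - ?g \<nu>'"
    by (simp add: grad d_def[symmetric] norm_minus_commute[of \<nu> \<nu>']
        inner_commute inner_diff_right)
qed

section \<open>Strong duality\<close>

text \<open>The gradient at a constrained minimizer is orthogonal to the kernel of \<open>A\<close>. Injectivity of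
  \<open>A\<^sup>T\<close> makes \<open>A A\<^sup>T\<close> invertible. Taking \<open>\<nu>\<close> with \<open>A A\<^sup>T \<nu> = - A grad f x\<close>, the vector \<open>grad f x + A\<^sup>T \<nu>\<close> lies in the kernel and is orthogonal
  to both of its summands, hence to itself.\<close>

lemma lagrange_multiplier_exists:
  fixes f :: "real^'n \<Rightarrow> real" and A :: "real^'n^'m"
  assumes D: "GDERIV f x :> grad f x" and inj: "inj ((*v) (transpose A))"
    and min: "is_arg_min f (\<lambda>x. A *v x = b) x"
  shows "\<exists>\<nu>. grad f x = - (transpose A *v \<nu>)"
proof -
  let ?M = "\<lambda>\<nu>. A *v (transpose A *v \<nu>)"
  have lin: "linear ?M"
    using linear_compose[OF matrix_vector_mul_linear[of "transpose A"] matrix_vector_mul_linear[of A]]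
    by (simp only: o_def)
  have "\<nu> = 0" if "?M \<nu> = 0" for \<nu>
  proof -
    have "(transpose A *v \<nu>) \<bullet> (transpose A *v \<nu>) = \<nu> \<bullet> ?M \<nu>"
      by (simp only: inner_matrix_transpose[of \<nu> A])
    also have "\<dots> = 0" unfolding that by simp
    finally have "transpose A *v \<nu> = 0" by (simp only: inner_eq_zero_iff)
    then show ?thesis using inj by (metis injD matrix_vector_mult_0_right)
  qed
  then have "inj ?M" using linear_injective_0[OF lin] by blast
  then have "surj ?M" using lin linear_injective_imp_surjective by blast
  then obtain \<nu> where \<nu>: "?M \<nu> = - (A *v grad f x)" by (metis surjD)
  define w where "w = grad f x + transpose A *v \<nu>"
  have Aw: "A *v w = 0" unfolding w_def matrix_vector_right_distrib \<nu> by simp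
  have "(\<lambda>s. s * (w \<bullet> grad f x)) = (\<lambda>s. 0)"
  proof (rule differential_zero_maxmin[of 0 UNIV "\<lambda>s. f (x + s *\<^sub>R w)"])
    have "((\<lambda>s. x + s *\<^sub>R w) has_derivative (\<lambda>s. s *\<^sub>R w)) (at 0)"
      by (auto intro!: derivative_eq_intros)
    moreover have "(f has_derivative (\<lambda>h. h \<bullet> grad f x)) (at (x + 0 *\<^sub>R w))"
      using D by (simp add: gderiv_def)
    ultimately have "((\<lambda>s. f (x + s *\<^sub>R w)) has_derivative (\<lambda>s. (s *\<^sub>R w) \<bullet> grad f x)) (at 0)"
      by (rule has_derivative_compose)
    then show "((\<lambda>s. f (x + s *\<^sub>R w)) has_derivative (\<lambda>s. s * (w \<bullet> grad f x))) (at 0)" by simp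
    show "(\<forall>s\<in>UNIV. f (x + s *\<^sub>R w) \<le> f (x + 0 *\<^sub>R w)) \<or> (\<forall>s\<in>UNIV. f (x + 0 *\<^sub>R w) \<le> f (x + s *\<^sub>R w))"
      using min Aw
      by (simp add: is_arg_min_linorder matrix_vector_right_distrib matrix_vector_mult_scaleR)
  qed simp_all
  from fun_cong[OF this, of 1] have "w \<bullet> grad f x = 0" by simp
  moreover have "w \<bullet> (transpose A *v \<nu>) = 0"
    using inner_matrix_transpose[of \<nu> A w] Aw by (simp add: inner_commute)
  ultimately have "w \<bullet> w = 0" by (simp add: w_def inner_add_right)
  then show ?thesis by (auto simp: w_def add_eq_0_iff2)
qed

text \<open>With a Lagrange multiplier \<open>\<nu>\<close> for \<open>x\<close>, convexity makes \<open>x\<close> minimize the Lagrangian at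
  \<open>\<nu>\<close>, so the dual optimum is at least \<open>f x\<close>. Since \<open>x\<close> is feasible, every Lagrangian takes the
  value \<open>f x\<close> there; hence at any dual maximizer the point \<open>x\<close> attains the infimum.\<close>

lemma constrained_minimizer_minimizes_lagrangian:
  fixes f :: "real^'n \<Rightarrow> real" and A :: "real^'n^'m"
  assumes D: "\<And>x. GDERIV f x :> grad f x" and "\<beta> > 0" and sc: "strongly_convex \<beta> f"
    and inj: "inj ((*v) (transpose A))"
    and min: "is_arg_min f (\<lambda>x. A *v x = b) x"
    and max: "is_arg_max (dual_function f A b) (\<lambda>_. True) \<nu>max"
  shows "lagrangian f A b x \<nu>max \<le> lagrangian f A b y \<nu>max"
proof -
  have feasible: "lagrangian f A b x \<nu> = f x" for \<nu>
    using min by (simp add: is_arg_min_def lagrangian_def)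
  obtain \<nu> where \<nu>: "grad f x = - (transpose A *v \<nu>)"
    using lagrange_multiplier_exists[OF D inj min] by blast
  have "lagrangian f A b x \<nu> \<le> lagrangian f A b y \<nu>" for y
  proof -
    have "0 \<le> \<beta> / 2 * (norm (x - y))\<^sup>2" using \<open>\<beta> > 0\<close> by simp
    then show ?thesis
      using strongly_convexD[OF strongly_convex_lagrangian[OF D sc], of A b x \<nu> y]
      unfolding grad_lagrangian[OF D] by (simp add: \<nu>)
  qed
  then have "dual_function f A b \<nu> = f x"
    using dual_function_eq_lagrangian feasible by metis
  then have "f x \<le> dual_function f A b \<nu>max"
    using max by (metis is_arg_max_linorder)
  also have "\<dots> \<le> lagrangian f A b y \<nu>max"
    by (rule dual_function_le_lagrangian[OF D \<open>\<beta> > 0\<close> sc])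
  finally show ?thesis by (simp add: feasible)
qed

theorem theorem4:
  fixes A :: "real^'n^'m" and b :: "real^'m"
    and f :: "real^'n \<Rightarrow> real" and \<beta>1 \<beta>2 :: real
    and xstar :: "real^'n" and \<nu>star :: "real^'m"
    and L :: "real^'n \<Rightarrow> real^'m \<Rightarrow> real" and g :: "real^'m \<Rightarrow> real"
    and c1 c2 d1 d2 p1 p2 q1 q2 \<alpha>1 \<alpha>2 \<alpha>3 \<alpha>4 :: real
  assumes "rank A = CARD('m)"
    and "C11_loc f" and "coercive f"
    and "\<beta>1 > 0" and "strongly_convex \<beta>1 f"
    and "\<beta>2 > 0" and "strongly_smooth \<beta>2 f"
    and "C11_loc (conjugate f)"
    and "is_arg_min f (\<lambda>x. A *v x = b) xstar"
    and "L = lagrangian f A b"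
    and "g = dual_function f A b"
    and "is_arg_max g (\<lambda>_. True) \<nu>star"
    and "c1 > 0" and "c2 > 0" and "d1 > 0" and "d2 > 0"
    and "p1 > 2" and "q1 > 2" and "1 < p2" and "p2 < 2" and "1 < q2" and "q2 < 2"
    and "\<alpha>1 = 2 - (p1 - 2) / (p1 - 1)"
    and "\<alpha>2 = 2 - (p2 - 2) / (p2 - 1)"
    and "\<alpha>3 = 2 - (q1 - 2) / (q1 - 1)"
    and "\<alpha>4 = 2 - (q2 - 2) / (q2 - 1)"
  shows "(\<exists>\<mu>g. PL_constant (\<lambda>\<nu>. - g \<nu>) \<mu>g) \<and>
         (\<exists>\<mu>L. PL_constant (\<lambda>x. L x \<nu>star) \<mu>L) \<and>
         (\<forall>\<mu>g \<mu>L k3 k4 k5 k6.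
            PL_constant (\<lambda>\<nu>. - g \<nu>) \<mu>g \<longrightarrow>
            PL_constant (\<lambda>x. L x \<nu>star) \<mu>L \<longrightarrow>
            k3 = c1 * 2 powr ((2 + 3 * \<alpha>1) / 4) * \<mu>g powr (\<alpha>1 / 2) \<longrightarrow>
            k4 = c2 * 2 powr ((2 + 3 * \<alpha>2) / 4) * \<mu>g powr (\<alpha>2 / 2) \<longrightarrow>
            k5 = d1 * 2 powr ((2 + 3 * \<alpha>3) / 4) * \<mu>L powr (\<alpha>3 / 2) \<longrightarrow>
            k6 = d2 * 2 powr ((2 + 3 * \<alpha>4) / 4) * \<mu>L powr (\<alpha>4 / 2) \<longrightarrow>
            (\<exists>T\<nu>\<ge>0. \<exists>Tx\<ge>0.
               (\<forall>\<nu>. trajectory (\<lambda>v. fixed_time_field c1 c2 p1 p2 (grad g v)) \<nu> \<longrightarrow>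
                    (\<forall>t\<ge>T\<nu>. \<nu> t = \<nu>star)) \<and>
               (\<forall>x. trajectory (\<lambda>y. - fixed_time_field d1 d2 q1 q2 (grad (\<lambda>z. L z \<nu>star) y)) x \<longrightarrow>
                    (\<forall>t\<ge>Tx. x t = xstar)) \<and>
               T\<nu> + Tx \<le> 4 / (k3 * (2 - \<alpha>1)) + 4 / (k4 * (\<alpha>2 - 2))
                        + 4 / (k5 * (2 - \<alpha>3)) + 4 / (k6 * (\<alpha>4 - 2))))"
proof -
  have D: "\<And>x. GDERIV f x :> grad f x" using assms(2) by (simp add: C11_loc_def)
  have inj: "inj ((*v) (transpose A))"
    using assms(1) by (simp add: full_rank_injective[symmetric] rank_transpose)
  obtain \<sigma> where \<sigma>: "\<sigma> > 0" "\<And>\<nu>. \<sigma> * norm \<nu> \<le> norm (transpose A *v \<nu>)"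
    using linear_inj_bounded_below_pos[OF matrix_vector_mul_linear inj] by blast
  note L = \<open>L = lagrangian f A b\<close> and g = \<open>g = dual_function f A b\<close>

  have gD: "GDERIV g \<nu> :> grad g \<nu>" for \<nu>
    unfolding g by (rule GDERIV_grad_dual_function[OF D assms(4,5)])
  have grad_neg: "grad (\<lambda>\<nu>. - g \<nu>) \<nu> = - grad g \<nu>" for \<nu>
    by (rule grad_eqI[OF GDERIV_minus[OF gD]])
  have negD: "GDERIV (\<lambda>\<nu>. - g \<nu>) \<nu> :> grad (\<lambda>\<nu>. - g \<nu>) \<nu>" for \<nu>
    unfolding grad_neg by (rule GDERIV_minus[OF gD])
  have gsc: "strongly_convex (\<sigma>\<^sup>2 / \<beta>2) (\<lambda>\<nu>. - g \<nu>)"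
    unfolding g using \<sigma>
    by (intro strongly_convex_uminus_dual_function[OF D assms(4-7)]) auto
  have g\<beta>: "\<sigma>\<^sup>2 / \<beta>2 > 0" using \<sigma> assms(6) by simp
  have gmin: "- g \<nu>star \<le> - g y" for y
    using assms(12) by (simp add: is_arg_max_linorder)

  have LD: "GDERIV (\<lambda>x. L x \<nu>star) x :> grad (\<lambda>x. L x \<nu>star) x" for x
    unfolding L grad_lagrangian[OF D] by (rule GDERIV_lagrangian[OF D])
  have Lsc: "strongly_convex \<beta>1 (\<lambda>x. L x \<nu>star)"
    unfolding L by (rule strongly_convex_lagrangian[OF D assms(5)])
  have Lmin: "L xstar \<nu>star \<le> L y \<nu>star" for y
    unfolding L
    by (rule constrained_minimizer_minimizes_lagrangian[OF D assms(4,5) inj assms(9)])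
      (use assms(12) g in simp)

  show ?thesis
  proof (intro conjI allI impI)
    show "\<exists>\<mu>g. PL_constant (\<lambda>\<nu>. - g \<nu>) \<mu>g"
      using strongly_convex_imp_PL_constant[OF g\<beta> gsc gmin] by blast
    show "\<exists>\<mu>L. PL_constant (\<lambda>x. L x \<nu>star) \<mu>L"
      using strongly_convex_imp_PL_constant[OF assms(4) Lsc Lmin] by blast
  next
    fix \<mu>g \<mu>L k3 k4 k5 k6
    assume PLg: "PL_constant (\<lambda>\<nu>. - g \<nu>) \<mu>g" and PLL: "PL_constant (\<lambda>x. L x \<nu>star) \<mu>L"
      and k3: "k3 = c1 * 2 powr ((2 + 3 * \<alpha>1) / 4) * \<mu>g powr (\<alpha>1 / 2)"
      and k4: "k4 = c2 * 2 powr ((2 + 3 * \<alpha>2) / 4) * \<mu>g powr (\<alpha>2 / 2)"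
      and k5: "k5 = d1 * 2 powr ((2 + 3 * \<alpha>3) / 4) * \<mu>L powr (\<alpha>3 / 2)"
      and k6: "k6 = d2 * 2 powr ((2 + 3 * \<alpha>4) / 4) * \<mu>L powr (\<alpha>4 / 2)"
    define T\<nu> where "T\<nu> = 4 / (k3 * (2 - \<alpha>1)) + 4 / (k4 * (\<alpha>2 - 2))"
    define Tx where "Tx = 4 / (k5 * (2 - \<alpha>3)) + 4 / (k6 * (\<alpha>4 - 2))"
    have \<alpha>: "\<alpha>1 \<le> 2" "2 \<le> \<alpha>2" "\<alpha>3 \<le> 2" "2 \<le> \<alpha>4"
      using assms(17-22) unfolding assms(23-26)
      by (simp_all add: zero_le_divide_iff divide_le_0_iff)
    have "k3 \<ge> 0" "k4 \<ge> 0" "k5 \<ge> 0" "k6 \<ge> 0"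
      using assms(13-16) by (simp_all add: k3 k4 k5 k6)
    with \<alpha> have "T\<nu> \<ge> 0" "Tx \<ge> 0" by (simp_all add: T\<nu>_def Tx_def)
    moreover have "\<nu> t = \<nu>star"
      if traj: "trajectory (\<lambda>v. fixed_time_field c1 c2 p1 p2 (grad g v)) \<nu>" and "t \<ge> T\<nu>" for \<nu> t
    proof (rule normalized_gradient_flow_fixed_time[OF negD g\<beta> gsc gmin PLg
          assms(13,14,17,19,20,23,24) k3 k4])
      \<comment> \<open>The field is odd, so ascent for \<open>g\<close> is descent for \<open>- g\<close>.\<close>
      show "trajectory (\<lambda>y. - fixed_time_field c1 c2 p1 p2 (grad (\<lambda>\<nu>. - g \<nu>) y)) \<nu>"
        using traj by (simp add: grad_neg fixed_time_field_uminus)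
    qed (use \<open>t \<ge> T\<nu>\<close> in \<open>simp add: T\<nu>_def\<close>)
    moreover have "x t = xstar"
      if "trajectory (\<lambda>y. - fixed_time_field d1 d2 q1 q2 (grad (\<lambda>z. L z \<nu>star) y)) x" and "t \<ge> Tx"
      for x t
      by (rule normalized_gradient_flow_fixed_time[OF LD assms(4) Lsc Lmin PLL
            assms(15,16,18,21,22,25,26) k5 k6 that(1)])
        (use \<open>t \<ge> Tx\<close> in \<open>simp add: Tx_def\<close>)
    moreover have "T\<nu> + Tx \<le> 4 / (k3 * (2 - \<alpha>1)) + 4 / (k4 * (\<alpha>2 - 2))
        + 4 / (k5 * (2 - \<alpha>3)) + 4 / (k6 * (\<alpha>4 - 2))"
      by (simp add: T\<nu>_def Tx_def)
    ultimately show "\<exists>T\<nu>\<ge>0. \<exists>Tx\<ge>0.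
        (\<forall>\<nu>. trajectory (\<lambda>v. fixed_time_field c1 c2 p1 p2 (grad g v)) \<nu> \<longrightarrow>
             (\<forall>t\<ge>T\<nu>. \<nu> t = \<nu>star)) \<and>
        (\<forall>x. trajectory (\<lambda>y. - fixed_time_field d1 d2 q1 q2 (grad (\<lambda>z. L z \<nu>star) y)) x \<longrightarrow>
             (\<forall>t\<ge>Tx. x t = xstar)) \<and>
        T\<nu> + Tx \<le> 4 / (k3 * (2 - \<alpha>1)) + 4 / (k4 * (\<alpha>2 - 2))
                 + 4 / (k5 * (2 - \<alpha>3)) + 4 / (k6 * (\<alpha>4 - 2))"
      by blast
  qed
qed

end
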